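(* Let $\{a_n\}_{n\ge 0}$ and $\{b_n\}_{n\ge 0}$ be real sequences with $a_n>0$ for all $n$, $a_n\to a$ and $b_n\to b$ with $a,b$ finite, and let $J$ be the associated Jacobi matrix, with spectral measure $\mu$, support $X$, orthonormal polynomials $\{p_n\}_{n\ge0}$ and heat operators $W_t$, $t\ge 0$, as defined in the context. Then for each sequence $f\in \ell^2(\mathbb{N})$ and each $t\ge 0$, $$\|W_tf\|_{\ell^2(\mathbb{N})}\le \|f\|_{\ell^2(\mathbb{N})}.$$ Moreover, for each $f\in\ell^2(\mathbb{N})$: (a) $W_{t_1}W_{t_2}f(n)=W_{t_1+t_2}f(n)$ for all $t_1,t_2\ge 0$ and $n\in\mathbb{N}$; (b) $W_0f(n)=f(n)$ for all $n\in\mathbb{N}$; (c) $\lim_{t\to 0^+}\|W_tf-f\|_{\ell^2(\mathbb{N})}=0$.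
   Context: Here $\mathbb{N}=\{0,1,2,\dots\}$ and sequences are real-valued. The Jacobi matrix $J$ is the infinite symmetric tridiagonal matrix with diagonal entries $b_0,b_1,b_2,\dots$ and off-diagonal entries $a_0,a_1,a_2,\dots$, i.e. $Jf(n)=a_{n-1}f(n-1)+b_nf(n)+a_nf(n+1)$ for $n\ge1$ and $Jf(0)=b_0f(0)+a_0f(1)$. Since $\{a_n\}$ and $\{b_n\}$ are bounded, $J$ is a bounded self-adjoint operator on $\ell^2(\mathbb{N})$. By Favard's theorem there are a positive Borel measure $\mu$ on $\mathbb{R}$ whose support $X$ is compact and infinite, and real polynomials $p_n$ of degree $n$ such that $\int_X p_np_m\,d\mu=\delta_{nm}$ and $xp_n(x)=a_{n-1}p_{n-1}(x)+b_np_n(x)+a_np_{n+1}(x)$ for $n\ge 0$, with $p_{-1}=0$; under the convergence assumptions on $a_n,b_n$ the measure is unique and $\{p_n\}_{n\ge0}$ is a complete orthonormal system in $L^2(X,\mu)$. Let $s=\max X$ and $s^+=\max\{s,0\}$. For $t\ge 0$ put $$K_t(m,n)=\int_X e^{(x-s^+)t}p_m(x)p_n(x)\,d\mu(x),\qquad W_tf(n)=\sum_{m=0}^\infty f(m)K_t(m,n).$$ *)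

theory Defs
  imports "HOL-Analysis.Analysis" "HOL-Computational_Algebra.Polynomial"
begin

definition ell2 :: "(nat \<Rightarrow> real) set" where
  "ell2 = {f. summable (\<lambda>n. (f n)\<^sup>2)}"

(* Meaningful only on ell2: suminf is unspecified for divergent series. *)
definition ell2_norm :: "(nat \<Rightarrow> real) \<Rightarrow> real" where
  "ell2_norm f = sqrt (\<Sum>n. (f n)\<^sup>2)"

fun jacobi :: "(nat \<Rightarrow> real) \<Rightarrow> (nat \<Rightarrow> real) \<Rightarrow> (nat \<Rightarrow> real) \<Rightarrow> nat \<Rightarrow> real" where
  "jacobi a b f 0 = b 0 * f 0 + a 0 * f 1"
| "jacobi a b f (Suc n) = a n * f n + b (Suc n) * f (Suc n) + a (Suc n) * f (Suc (Suc n))"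

definition measure_support :: "real measure \<Rightarrow> real set" where
  "measure_support \<mu> = {x. \<forall>U. open U \<and> x \<in> U \<longrightarrow> emeasure \<mu> U > 0}"

(* The data provided by Favard's theorem. The recurrence says that (p n x) is a formal
   eigenvector of the Jacobi matrix with eigenvalue x, which includes the convention
   p_{-1} = 0. The total mass of \<mu> is not normalised: p 0 is only required to be a
   constant making the system orthonormal; rescaling does not change the heat kernel. *)
definition jacobi_spectral_pair ::
    "(nat \<Rightarrow> real) \<Rightarrow> (nat \<Rightarrow> real) \<Rightarrow> real measure \<Rightarrow> (nat \<Rightarrow> real poly) \<Rightarrow> bool" where
  "jacobi_spectral_pair a b \<mu> p \<longleftrightarrow>
     sets \<mu> = sets borel \<and>
     compact (measure_support \<mu>) \<and>
     infinite (measure_support \<mu>) \<and>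
     (\<forall>n. degree (p n) = n) \<and>
     (\<forall>n m. set_integrable \<mu> (measure_support \<mu>) (\<lambda>x. poly (p n) x * poly (p m) x) \<and>
            (LINT x:measure_support \<mu>|\<mu>. poly (p n) x * poly (p m) x) = (if n = m then 1 else 0)) \<and>
     (\<forall>n x. x * poly (p n) x = jacobi a b (\<lambda>k. poly (p k) x) n)"

(* For a nonempty compact support, Sup is its maximum s. *)
definition heat_kernel :: "real measure \<Rightarrow> (nat \<Rightarrow> real poly) \<Rightarrow> real \<Rightarrow> nat \<Rightarrow> nat \<Rightarrow> real" where
  "heat_kernel \<mu> p t m n =
     (LINT x:measure_support \<mu>|\<mu>.
        exp ((x - max (Sup (measure_support \<mu>)) 0) * t) * poly (p m) x * poly (p n) x)"

definition heat_op ::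
    "real measure \<Rightarrow> (nat \<Rightarrow> real poly) \<Rightarrow> real \<Rightarrow> (nat \<Rightarrow> real) \<Rightarrow> nat \<Rightarrow> real" where
  "heat_op \<mu> p t f n = (\<Sum>m. f m * heat_kernel \<mu> p t m n)"

end

theory Submission
  imports Defs
begin

text \<open>
  Let \<open>X\<close> be the support of \<open>\<mu>\<close>. The map \<open>f \<mapsto> \<Sum>m. f m * p m\<close> identifies \<open>\<ell>\<^sup>2\<close> with
  \<open>L\<^sup>2(X, \<mu>)\<close>, and under this identification the heat operator is multiplication by the function
  \<open>x \<mapsto> exp ((x - s\<^sup>+) * t)\<close>. All the claims are properties of multiplication operators: this
  function has values in \<open>{0<..1}\<close> on \<open>X\<close>, so the operator is a contraction; the functions multiply
  when the times are added; at time \<open>0\<close> the function is \<open>1\<close>; and since \<open>X\<close> is bounded, the function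
  differs from \<open>1\<close> by at most a constant times \<open>t\<close>, which gives continuity at \<open>0\<close> even in operator
  norm.

  The proof therefore treats, for an arbitrary continuous \<open>g\<close> on \<open>X\<close>, the operator \<open>mult_op g\<close> whose
  matrix has entries \<open>\<integral> g * p m * p n\<close>. It stays with continuous functions and never forms the
  space \<open>L\<^sup>2\<close>. Bessel's inequality applied to \<open>g\<close> times a polynomial bounds the operator on finitely
  supported sequences, and a limit extends the bound to \<open>\<ell>\<^sup>2\<close> (\<open>mult_op_bound\<close>). Multiplicativity
  in \<open>g\<close> (\<open>mult_op_compose\<close>) is where completeness enters: for basis vectors it is Parseval's
  identity for two continuous functions (\<open>parseval_inner\<close>), which follows from the Weierstrass
  theorem because the \<open>p n\<close>, having degrees \<open>0, 1, 2, \<dots>\<close>, span all polynomials.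
\<close>

section \<open>Square-summable sequences\<close>

lemma ell2_summable_mult:
  assumes "f \<in> ell2" and "g \<in> ell2"
  shows "summable (\<lambda>n. f n * g n)"
proof (rule summable_comparison_test')
  show "summable (\<lambda>n. (f n)\<^sup>2 + (g n)\<^sup>2)"
    using assms by (auto simp: ell2_def intro: summable_add)
  have "\<bar>x * y\<bar> \<le> x\<^sup>2 + y\<^sup>2" for x y :: real
    using sum_squares_bound[of "\<bar>x\<bar>" "\<bar>y\<bar>"] abs_ge_zero[of "x * y"]
    unfolding abs_mult power2_abs by linarith
  then show "norm (f n * g n) \<le> (f n)\<^sup>2 + (g n)\<^sup>2" if "n \<ge> 0" for n
    by simp
qed

lemma ell2_sum_le:
  assumes "f \<in> ell2"
  shows "(\<Sum>n<N. (f n)\<^sup>2) \<le> (ell2_norm f)\<^sup>2"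
  using assms sum_le_suminf[of "\<lambda>n. (f n)\<^sup>2" "{..<N}"]
  by (simp add: ell2_def ell2_norm_def suminf_nonneg)

lemma ell2_norm_nonneg: "f \<in> ell2 \<Longrightarrow> ell2_norm f \<ge> 0"
  by (simp add: ell2_def ell2_norm_def suminf_nonneg)

lemma ell2_boundI:
  assumes "\<And>N. (\<Sum>n<N. (f n)\<^sup>2) \<le> B\<^sup>2" and "B \<ge> 0"
  shows "f \<in> ell2" and "ell2_norm f \<le> B"
proof -
  have s: "summable (\<lambda>n. (f n)\<^sup>2)"
    by (rule summableI_nonneg_bounded[of _ "B\<^sup>2"]) (use assms in auto)
  then show "f \<in> ell2"
    by (simp add: ell2_def)
  have "(\<Sum>n. (f n)\<^sup>2) \<le> B\<^sup>2"
    by (rule suminf_le_const[OF s assms(1)])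
  then show "ell2_norm f \<le> B"
    unfolding ell2_norm_def using assms(2) real_le_lsqrt by blast
qed

lemma abs_le_ell2_norm:
  assumes "f \<in> ell2"
  shows "\<bar>f n\<bar> \<le> ell2_norm f"
proof -
  have "(f n)\<^sup>2 \<le> (\<Sum>k<Suc n. (f k)\<^sup>2)"
    by (simp add: sum_nonneg)
  also have "\<dots> \<le> (ell2_norm f)\<^sup>2"
    by (rule ell2_sum_le[OF assms])
  finally show ?thesis
    using abs_le_square_iff[of "f n" "ell2_norm f"] ell2_norm_nonneg[OF assms] by simp
qed

lemma ell2_tail:
  assumes "f \<in> ell2"
  shows "(\<lambda>m. if m < M then 0 else f m) \<in> ell2"
  unfolding ell2_def mem_Collect_eq
  by (rule summable_comparison_test'[where g = "\<lambda>n. (f n)\<^sup>2"])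
     (use assms in \<open>auto simp: ell2_def\<close>)

lemma ell2_norm_tail_tendsto_0:
  assumes "f \<in> ell2"
  shows "(\<lambda>M. ell2_norm (\<lambda>m. if m < M then 0 else f m)) \<longlonglongrightarrow> 0"
proof -
  have s: "summable (\<lambda>n. (f n)\<^sup>2)"
    using assms by (simp add: ell2_def)
  have "(\<Sum>m. (if m < M then 0 else f m)\<^sup>2) = (\<Sum>m. (f m)\<^sup>2) - (\<Sum>m<M. (f m)\<^sup>2)" for M
  proof -
    have "(\<lambda>m. if m \<in> {..<M} then (f m)\<^sup>2 else 0) sums (\<Sum>m<M. (f m)\<^sup>2)"
      by (rule sums_If_finite_set) simp
    from sums_diff[OF summable_sums[OF s] this]
    have "(\<lambda>m. (f m)\<^sup>2 - (if m \<in> {..<M} then (f m)\<^sup>2 else 0)) sums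
            ((\<Sum>m. (f m)\<^sup>2) - (\<Sum>m<M. (f m)\<^sup>2))" .
    also have "(\<lambda>m. (f m)\<^sup>2 - (if m \<in> {..<M} then (f m)\<^sup>2 else 0)) =
                 (\<lambda>m. (if m < M then 0 else f m)\<^sup>2)"
      by auto
    finally show ?thesis
      by (simp add: sums_iff)
  qed
  moreover have "(\<lambda>M. sqrt ((\<Sum>m. (f m)\<^sup>2) - (\<Sum>m<M. (f m)\<^sup>2))) \<longlonglongrightarrow>
                   sqrt ((\<Sum>m. (f m)\<^sup>2) - (\<Sum>m. (f m)\<^sup>2))"
    by (intro tendsto_intros summable_LIMSEQ s)
  ultimately show ?thesis
    by (simp add: ell2_norm_def)
qed

section \<open>Orthonormal polynomials on a compact set\<close>

text \<open>
  The measure lives on the compact set itself, as the space of \<open>\<nu>\<close>, rather than on the whole line: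
  every function continuous there is then integrable, whatever it does elsewhere, and bounds on the
  set pass to integrals without null sets.
\<close>

locale orthonormal_polynomials = finite_measure \<nu> for \<nu> :: "real measure" +
  fixes p :: "nat \<Rightarrow> real poly"
  assumes compact_space: "compact (space \<nu>)"
    and sets_\<nu>: "sets \<nu> = sets (restrict_space borel (space \<nu>))"
    and degree_p: "degree (p n) = n"
    and orthonormal: "(\<integral>x. poly (p n) x * poly (p m) x \<partial>\<nu>) = (if n = m then 1 else 0)"
begin

abbreviation X :: "real set" where
  "X \<equiv> space \<nu>"

definition coef :: "(real \<Rightarrow> real) \<Rightarrow> nat \<Rightarrow> real" where
  "coef h n = (\<integral>x. h x * poly (p n) x \<partial>\<nu>)"

definition mult_matrix :: "(real \<Rightarrow> real) \<Rightarrow> nat \<Rightarrow> nat \<Rightarrow> real" where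
  "mult_matrix g m n = (\<integral>x. g x * poly (p m) x * poly (p n) x \<partial>\<nu>)"

definition mult_op :: "(real \<Rightarrow> real) \<Rightarrow> (nat \<Rightarrow> real) \<Rightarrow> nat \<Rightarrow> real" where
  "mult_op g f n = (\<Sum>m. f m * mult_matrix g m n)"

lemma integrable_continuous:
  fixes h :: "real \<Rightarrow> real"
  assumes "continuous_on X h"
  shows "integrable \<nu> h"
proof -
  have "bounded (h ` X)"
    using assms compact_space by (intro compact_imp_bounded compact_continuous_image)
  then obtain B where B: "\<And>x. x \<in> X \<Longrightarrow> norm (h x) \<le> B"
    by (auto simp: bounded_iff)
  have "h \<in> borel_measurable (restrict_space borel X)"
    by (rule borel_measurable_continuous_on_restrict[OF assms])
  then have meas: "h \<in> borel_measurable \<nu>"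
    using measurable_cong_sets[OF sets_\<nu> refl] by blast
  have "AE x in \<nu>. norm (h x) \<le> B"
    using B by (rule AE_I2)
  then show ?thesis
    using meas by (rule integrable_const_bound)
qed

text \<open>
  Completing the square coefficient by coefficient. Choosing \<open>d n = coef h n\<close> gives Bessel's
  inequality; a general \<open>d\<close> shows that no combination of the \<open>p n\<close> approximates \<open>h\<close> better than the
  orthogonal projection; and \<open>h = 0\<close> gives the norm of a polynomial in terms of its coefficients.
\<close>

lemma square_distance_expansion:
  assumes h: "continuous_on X h"
  shows "(\<integral>x. (h x - (\<Sum>n<N. d n * poly (p n) x))\<^sup>2 \<partial>\<nu>) =
           (\<integral>x. (h x)\<^sup>2 \<partial>\<nu>) - (\<Sum>n<N. (coef h n)\<^sup>2) + (\<Sum>n<N. (d n - coef h n)\<^sup>2)"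
proof (induction N)
  case 0
  then show ?case by simp
next
  case (Suc N)
  define r where "r = (\<lambda>x. h x - (\<Sum>n<N. d n * poly (p n) x))"
  have r: "continuous_on X r"
    unfolding r_def by (intro continuous_intros h)
  have "(\<integral>x. r x * poly (p N) x \<partial>\<nu>) =
          (\<integral>x. h x * poly (p N) x - (\<Sum>n<N. d n * (poly (p n) x * poly (p N) x)) \<partial>\<nu>)"
    by (simp add: r_def left_diff_distrib sum_distrib_right mult.assoc)
  also have "\<dots> = coef h N - (\<Sum>n<N. d n * (\<integral>x. poly (p n) x * poly (p N) x \<partial>\<nu>))"
    unfolding coef_def
    by (subst Bochner_Integration.integral_diff Bochner_Integration.integral_sum;
        (intro integrable_continuous continuous_intros h)?)
       (simp add: Bochner_Integration.integral_sum integrable_continuous continuous_intros)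
  also have "\<dots> = coef h N"
    by (simp add: orthonormal)
  finally have rp: "(\<integral>x. r x * poly (p N) x \<partial>\<nu>) = coef h N" .
  have "(\<integral>x. (h x - (\<Sum>n<Suc N. d n * poly (p n) x))\<^sup>2 \<partial>\<nu>) =
          (\<integral>x. (r x)\<^sup>2 - 2 * d N * (r x * poly (p N) x) + (d N)\<^sup>2 * (poly (p N) x * poly (p N) x) \<partial>\<nu>)"
    by (simp add: r_def power2_eq_square algebra_simps)
  also have "\<dots> = (\<integral>x. (r x)\<^sup>2 \<partial>\<nu>) - 2 * d N * coef h N + (d N)\<^sup>2"
    by (subst Bochner_Integration.integral_add Bochner_Integration.integral_diff;
        (intro integrable_continuous continuous_intros r)?)+
       (simp add: rp orthonormal)
  finally show ?case
    using Suc by (simp add: r_def power2_eq_square algebra_simps)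
qed

lemma bessel:
  assumes "continuous_on X h"
  shows "(\<Sum>n<N. (coef h n)\<^sup>2) \<le> (\<integral>x. (h x)\<^sup>2 \<partial>\<nu>)"
proof -
  have "0 \<le> (\<integral>x. (h x - (\<Sum>n<N. coef h n * poly (p n) x))\<^sup>2 \<partial>\<nu>)"
    by simp
  then show ?thesis
    by (simp add: square_distance_expansion[OF assms])
qed

text \<open>
  Since \<open>p N\<close> has exact degree \<open>N\<close>, subtracting a multiple of it removes the coefficient of degree
  \<open>N\<close>, and induction disposes of the rest. The inner claim bounds the degree by vanishing coefficients
  so that the zero polynomial is covered at \<open>N = 0\<close>.
\<close>

lemma poly_expansion:
  assumes "degree q < N"
  obtains d where "\<And>x. poly q x = (\<Sum>n<N. d n * poly (p n) x)"
proof -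
  have "\<exists>d. q = (\<Sum>n<N. smult (d n) (p n))" if "\<And>i. i \<ge> N \<Longrightarrow> coeff q i = 0" for q N
    using that
  proof (induction N arbitrary: q)
    case 0
    then have "q = 0" by (simp add: poly_eq_iff)
    then show ?case by simp
  next
    case (Suc N)
    have "p N \<noteq> 0"
      using orthonormal[of N N] by auto
    then have nz: "coeff (p N) N \<noteq> 0"
      by (metis degree_p leading_coeff_0_iff)
    define e where "e = coeff q N / coeff (p N) N"
    have "coeff (q - smult e (p N)) i = 0" if "i \<ge> N" for i
    proof (cases "i = N")
      case True
      then show ?thesis using nz by (simp add: e_def)
    next
      case False
      then show ?thesis
        using that Suc.prems[of i] by (simp add: coeff_eq_0 degree_p)
    qed
    from Suc.IH[OF this] obtain d where "q - smult e (p N) = (\<Sum>n<N. smult (d n) (p n))"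
      by blast
    then have "q = (\<Sum>n<N. smult (d n) (p n)) + smult e (p N)"
      by (simp add: algebra_simps)
    then have "q = (\<Sum>n<Suc N. smult ((d(N := e)) n) (p n))"
      by simp
    then show ?case by blast
  qed
  from this[of N q] obtain d where "q = (\<Sum>n<N. smult (d n) (p n))"
    using assms by (auto simp: coeff_eq_0)
  then have "poly q x = (\<Sum>n<N. d n * poly (p n) x)" for x
    by (simp add: poly_sum)
  then show ?thesis by (rule that)
qed

text \<open>
  A polynomial uniformly within \<open>e\<close> of \<open>h\<close> is at squared distance at most \<open>e\<^sup>2 * measure \<nu> X\<close> from
  \<open>h\<close>; the projection of \<open>h\<close> onto sufficiently many \<open>p n\<close> is at least as close, so the defect in
  Bessel's inequality is arbitrarily small.
\<close>

lemma parseval: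
  assumes h: "continuous_on X h"
  shows "(\<lambda>n. (coef h n)\<^sup>2) sums (\<integral>x. (h x)\<^sup>2 \<partial>\<nu>)"
proof -
  let ?I = "\<integral>x. (h x)\<^sup>2 \<partial>\<nu>"
  have s: "summable (\<lambda>n. (coef h n)\<^sup>2)"
    by (rule summableI_nonneg_bounded[of _ ?I]) (use bessel[OF h] in auto)
  have upper: "(\<Sum>n. (coef h n)\<^sup>2) \<le> ?I"
    by (rule suminf_le_const[OF s bessel[OF h]])
  have approx: "?I \<le> (\<Sum>n. (coef h n)\<^sup>2) + e\<^sup>2 * measure \<nu> X" if e: "e > 0" for e
  proof -
    obtain g where "real_polynomial_function g" and ge: "\<And>x. x \<in> X \<Longrightarrow> \<bar>h x - g x\<bar> < e"
      using Stone_Weierstrass_real_polynomial_function[OF compact_space h e] by blast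
    then obtain c k where g: "g = (\<lambda>x. \<Sum>i\<le>k. c i * x ^ i)"
      by (auto simp: real_polynomial_function_iff_sum)
    define q where "q = (\<Sum>i\<le>k. monom (c i) i)"
    have gq: "g x = poly q x" for x
      by (simp add: g q_def poly_sum poly_monom)
    obtain d where d: "\<And>x. poly q x = (\<Sum>n<Suc (degree q). d n * poly (p n) x)"
      using poly_expansion[of q "Suc (degree q)"] by blast
    let ?N = "Suc (degree q)"
    have "?I - (\<Sum>n<?N. (coef h n)\<^sup>2) \<le> (\<integral>x. (h x - (\<Sum>n<?N. d n * poly (p n) x))\<^sup>2 \<partial>\<nu>)"
      unfolding square_distance_expansion[OF h] by (simp add: sum_nonneg del: sum.lessThan_Suc)
    also have "\<dots> = (\<integral>x. (h x - poly q x)\<^sup>2 \<partial>\<nu>)"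
      by (simp only: d)
    also have "\<dots> \<le> (\<integral>x. e\<^sup>2 \<partial>\<nu>)"
    proof (rule integral_mono)
      show "integrable \<nu> (\<lambda>x. (h x - poly q x)\<^sup>2)"
        by (intro integrable_continuous continuous_intros h)
      show "(h x - poly q x)\<^sup>2 \<le> e\<^sup>2" if "x \<in> X" for x
        using ge[OF that] by (simp add: gq abs_le_square_iff[symmetric])
    qed simp
    also have "\<dots> = e\<^sup>2 * measure \<nu> X"
      by simp
    finally have "?I \<le> (\<Sum>n<?N. (coef h n)\<^sup>2) + e\<^sup>2 * measure \<nu> X"
      by simp
    moreover have "(\<Sum>n<?N. (coef h n)\<^sup>2) \<le> (\<Sum>n. (coef h n)\<^sup>2)"
      by (rule sum_le_suminf[OF s]) auto
    ultimately show ?thesis by linarith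
  qed
  have "((\<lambda>e. (\<Sum>n. (coef h n)\<^sup>2) + e\<^sup>2 * measure \<nu> X) \<longlongrightarrow>
           (\<Sum>n. (coef h n)\<^sup>2) + 0\<^sup>2 * measure \<nu> X) (at_right 0)"
    by (intro tendsto_intros)
  then have "?I \<le> (\<Sum>n. (coef h n)\<^sup>2) + 0\<^sup>2 * measure \<nu> X"
    by (rule tendsto_lowerbound)
       (auto simp: eventually_at_right_less intro!: eventually_mono[OF eventually_at_right_less] approx)
  with upper s show ?thesis
    by (simp add: sums_iff)
qed

lemma parseval_inner:
  assumes h: "continuous_on X h" and k: "continuous_on X k"
  shows "(\<lambda>n. coef h n * coef k n) sums (\<integral>x. h x * k x \<partial>\<nu>)"
proof -
  have add: "coef (\<lambda>x. h x + k x) n = coef h n + coef k n" for n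
    unfolding coef_def distrib_right
    by (intro Bochner_Integration.integral_add integrable_continuous continuous_intros h k)
  have diff: "coef (\<lambda>x. h x - k x) n = coef h n - coef k n" for n
    unfolding coef_def left_diff_distrib
    by (intro Bochner_Integration.integral_diff integrable_continuous continuous_intros h k)
  have "(\<lambda>n. ((coef (\<lambda>x. h x + k x) n)\<^sup>2 - (coef (\<lambda>x. h x - k x) n)\<^sup>2) / 4) sums
          (((\<integral>x. (h x + k x)\<^sup>2 \<partial>\<nu>) - (\<integral>x. (h x - k x)\<^sup>2 \<partial>\<nu>)) / 4)"
    by (intro sums_divide sums_diff parseval continuous_intros h k)
  also have "(\<lambda>n. ((coef (\<lambda>x. h x + k x) n)\<^sup>2 - (coef (\<lambda>x. h x - k x) n)\<^sup>2) / 4) =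
               (\<lambda>n. coef h n * coef k n)"
    by (simp add: add diff power2_eq_square algebra_simps)
  also have "((\<integral>x. (h x + k x)\<^sup>2 \<partial>\<nu>) - (\<integral>x. (h x - k x)\<^sup>2 \<partial>\<nu>)) / 4 =
               (\<integral>x. ((h x + k x)\<^sup>2 - (h x - k x)\<^sup>2) / 4 \<partial>\<nu>)"
    by (simp add: Bochner_Integration.integral_diff integrable_continuous continuous_intros h k)
  also have "\<dots> = (\<integral>x. h x * k x \<partial>\<nu>)"
    by (simp add: power2_eq_square algebra_simps)
  finally show ?thesis .
qed

section \<open>Multiplication operators in the orthonormal basis\<close>

lemma mult_matrix_coef: "mult_matrix g m n = coef (\<lambda>x. g x * poly (p m) x) n"
  by (simp add: mult_matrix_def coef_def)

lemma mult_matrix_commute: "mult_matrix g m n = mult_matrix g n m"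
  by (simp add: mult_matrix_def mult_ac)

lemma mult_matrix_row_ell2:
  assumes "continuous_on X g"
  shows "(\<lambda>m. mult_matrix g m n) \<in> ell2"
proof -
  have "summable (\<lambda>m. (coef (\<lambda>x. g x * poly (p n) x) m)\<^sup>2)"
    by (intro sums_summable[OF parseval] continuous_intros assms)
  then show ?thesis
    by (simp add: ell2_def mult_matrix_commute[of g _ n] flip: mult_matrix_coef)
qed

lemma mult_op_summable:
  assumes "continuous_on X g" and "f \<in> ell2"
  shows "summable (\<lambda>m. f m * mult_matrix g m n)"
  by (rule ell2_summable_mult[OF assms(2) mult_matrix_row_ell2[OF assms(1)]])

text \<open>
  For \<open>F = (\<Sum>m<M. f m * p m)\<close> the inner sums are the coefficients of \<open>g * F\<close>, so the left side is at
  most \<open>\<integral> (g * F)\<^sup>2 \<le> c\<^sup>2 * \<integral> F\<^sup>2\<close>.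
\<close>

lemma mult_op_finite_bound:
  assumes g: "continuous_on X g" and c: "\<And>x. x \<in> X \<Longrightarrow> \<bar>g x\<bar> \<le> c"
  shows "(\<Sum>n<N. (\<Sum>m<M. f m * mult_matrix g m n)\<^sup>2) \<le> c\<^sup>2 * (\<Sum>m<M. (f m)\<^sup>2)"
proof -
  define F where "F = (\<lambda>x. \<Sum>m<M. f m * poly (p m) x)"
  have F: "continuous_on X F"
    unfolding F_def by (intro continuous_intros)
  have "(\<Sum>m<M. f m * mult_matrix g m n) = coef (\<lambda>x. g x * F x) n" for n
  proof -
    have "coef (\<lambda>x. g x * F x) n = (\<integral>x. (\<Sum>m<M. f m * (g x * poly (p m) x * poly (p n) x)) \<partial>\<nu>)"
      by (simp add: coef_def F_def sum_distrib_left sum_distrib_right mult_ac)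
    also have "\<dots> = (\<Sum>m<M. f m * mult_matrix g m n)"
      by (simp add: mult_matrix_def Bochner_Integration.integral_sum integrable_continuous
            continuous_intros g)
    finally show ?thesis by simp
  qed
  then have "(\<Sum>n<N. (\<Sum>m<M. f m * mult_matrix g m n)\<^sup>2) \<le> (\<integral>x. (g x * F x)\<^sup>2 \<partial>\<nu>)"
    using bessel[of "\<lambda>x. g x * F x" N] g F by (simp add: continuous_on_mult)
  also have "\<dots> \<le> (\<integral>x. c\<^sup>2 * (F x)\<^sup>2 \<partial>\<nu>)"
  proof (intro integral_mono integrable_continuous continuous_intros g F)
    show "(g x * F x)\<^sup>2 \<le> c\<^sup>2 * (F x)\<^sup>2" if "x \<in> X" for x
      using c[OF that] by (simp add: power_mult_distrib mult_right_mono abs_le_square_iff[symmetric])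
  qed
  also have "\<dots> = c\<^sup>2 * (\<integral>x. (F x)\<^sup>2 \<partial>\<nu>)"
    by simp
  also have "(\<integral>x. (F x)\<^sup>2 \<partial>\<nu>) = (\<Sum>m<M. (f m)\<^sup>2)"
    using square_distance_expansion[of "\<lambda>_. 0" f M] by (simp add: F_def coef_def)
  finally show ?thesis .
qed

text \<open>
  The previous bound does not involve the number of output coordinates, so letting first \<open>M\<close> and then
  \<open>N\<close> tend to infinity extends it to \<open>\<ell>\<^sup>2\<close>.
\<close>

lemma mult_op_bound:
  assumes g: "continuous_on X g" and c: "\<And>x. x \<in> X \<Longrightarrow> \<bar>g x\<bar> \<le> c" "c \<ge> 0" and f: "f \<in> ell2"
  shows "mult_op g f \<in> ell2" and "ell2_norm (mult_op g f) \<le> c * ell2_norm f"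
proof -
  have bound: "(\<Sum>n<N. (mult_op g f n)\<^sup>2) \<le> (c * ell2_norm f)\<^sup>2" for N
  proof (rule tendsto_upperbound)
    show "(\<lambda>M. \<Sum>n<N. (\<Sum>m<M. f m * mult_matrix g m n)\<^sup>2) \<longlonglongrightarrow> (\<Sum>n<N. (mult_op g f n)\<^sup>2)"
      unfolding mult_op_def by (intro tendsto_intros summable_LIMSEQ mult_op_summable g f)
    have "(\<Sum>n<N. (\<Sum>m<M. f m * mult_matrix g m n)\<^sup>2) \<le> (c * ell2_norm f)\<^sup>2" for M
    proof -
      have "c\<^sup>2 * (\<Sum>m<M. (f m)\<^sup>2) \<le> c\<^sup>2 * (ell2_norm f)\<^sup>2"
        by (intro mult_left_mono ell2_sum_le[OF f]) simp
      with mult_op_finite_bound[OF g c(1), of f M N] show ?thesis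
        by (simp add: power_mult_distrib)
    qed
    then show "\<forall>\<^sub>F M in sequentially.
        (\<Sum>n<N. (\<Sum>m<M. f m * mult_matrix g m n)\<^sup>2) \<le> (c * ell2_norm f)\<^sup>2"
      by simp
  qed simp
  have "0 \<le> c * ell2_norm f"
    by (simp add: c ell2_norm_nonneg[OF f])
  with bound show "mult_op g f \<in> ell2" "ell2_norm (mult_op g f) \<le> c * ell2_norm f"
    by (blast intro: ell2_boundI)+
qed

lemma continuous_bounded_on_space:
  fixes g :: "real \<Rightarrow> real"
  assumes "continuous_on X g"
  obtains c where "c \<ge> 0" and "\<And>x. x \<in> X \<Longrightarrow> \<bar>g x\<bar> \<le> c"
proof -
  have "bounded (g ` X)"
    using assms compact_space by (intro compact_imp_bounded compact_continuous_image)
  then obtain B where "\<And>x. x \<in> X \<Longrightarrow> \<bar>g x\<bar> \<le> B"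
    by (auto simp: bounded_iff)
  then have "\<And>x. x \<in> X \<Longrightarrow> \<bar>g x\<bar> \<le> max B 0"
    by (meson max.coboundedI1)
  then show ?thesis
    using that[of "max B 0"] by simp
qed

text \<open>
  Both rows are coefficient sequences, of \<open>h * p j\<close> and of \<open>g * p n\<close>, so the matrix product is an inner
  product computed by Parseval's identity.
\<close>

lemma mult_matrix_product:
  assumes "continuous_on X g" and "continuous_on X h"
  shows "(\<lambda>m. mult_matrix h j m * mult_matrix g m n) sums mult_matrix (\<lambda>x. g x * h x) j n"
proof -
  have "(\<lambda>m. coef (\<lambda>x. h x * poly (p j) x) m * coef (\<lambda>x. g x * poly (p n) x) m) sums
          (\<integral>x. (h x * poly (p j) x) * (g x * poly (p n) x) \<partial>\<nu>)"
    by (intro parseval_inner continuous_intros assms)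
  then show ?thesis
    by (simp add: mult_matrix_coef[symmetric] mult_matrix_commute[of g n] mult_matrix_def mult_ac)
qed

text \<open>
  The left side is an iterated series, and square summability of \<open>f\<close> does not provide the absolute
  convergence that would allow exchanging the summations directly. Splitting off the first \<open>M\<close> terms of \<open>f\<close> leaves a finite sum, where the summations can be
  exchanged, and a tail, which the norm bounds of the two operators send to \<open>0\<close>.
\<close>

lemma mult_op_compose:
  assumes g: "continuous_on X g" and h: "continuous_on X h" and f: "f \<in> ell2"
  shows "mult_op g (mult_op h f) n = mult_op (\<lambda>x. g x * h x) f n"
proof -
  obtain c where c: "c \<ge> 0" "\<And>x. x \<in> X \<Longrightarrow> \<bar>g x\<bar> \<le> c"
    using continuous_bounded_on_space[OF g] by metis
  obtain d where d: "d \<ge> 0" "\<And>x. x \<in> X \<Longrightarrow> \<bar>h x\<bar> \<le> d"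
    using continuous_bounded_on_space[OF h] by metis
  let ?K = "mult_matrix (\<lambda>x. g x * h x)"
  define tail where "tail = (\<lambda>M m. if m < M then 0 else f m)"
  have tail: "tail M \<in> ell2" for M
    unfolding tail_def by (rule ell2_tail[OF f])
  have hf: "mult_op h f \<in> ell2" and htail: "mult_op h (tail M) \<in> ell2" for M
    using mult_op_bound(1)[OF h d(2,1)] f tail by auto
  have split: "mult_op h f m = (\<Sum>j<M. f j * mult_matrix h j m) + mult_op h (tail M) m" for M m
  proof -
    have "(\<lambda>j. if j \<in> {..<M} then f j * mult_matrix h j m else 0) sums (\<Sum>j<M. f j * mult_matrix h j m)"
      by (rule sums_If_finite_set) simp
    from sums_add[OF this summable_sums[OF mult_op_summable[OF h tail[of M]]]]
    have "(\<lambda>j. (if j \<in> {..<M} then f j * mult_matrix h j m else 0) + tail M j * mult_matrix h j m) sums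
            ((\<Sum>j<M. f j * mult_matrix h j m) + mult_op h (tail M) m)"
      by (simp add: mult_op_def)
    also have "(\<lambda>j. (if j \<in> {..<M} then f j * mult_matrix h j m else 0) + tail M j * mult_matrix h j m) =
                 (\<lambda>j. f j * mult_matrix h j m)"
      by (auto simp: tail_def)
    finally show ?thesis
      by (simp add: mult_op_def sums_iff)
  qed
  have eq: "mult_op g (mult_op h f) n = (\<Sum>j<M. f j * ?K j n) + mult_op g (mult_op h (tail M)) n" for M
  proof -
    have "(\<lambda>m. \<Sum>j<M. f j * (mult_matrix h j m * mult_matrix g m n)) sums (\<Sum>j<M. f j * ?K j n)"
      by (intro sums_sum sums_mult mult_matrix_product g h)
    from sums_add[OF this summable_sums[OF mult_op_summable[OF g htail[of M]]]]
    have "(\<lambda>m. mult_op h f m * mult_matrix g m n) sums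
            ((\<Sum>j<M. f j * ?K j n) + mult_op g (mult_op h (tail M)) n)"
      by (simp add: mult_op_def[of g] split[of _ M] distrib_right sum_distrib_right mult.assoc)
    then show ?thesis
      by (simp add: mult_op_def[of g "mult_op h f"] sums_iff)
  qed
  have "(\<lambda>M. mult_op g (mult_op h (tail M)) n) \<longlonglongrightarrow> 0"
  proof (rule Lim_null_comparison)
    have "norm (mult_op g (mult_op h (tail M)) n) \<le> c * (d * ell2_norm (tail M))" for M
    proof -
      have "\<bar>mult_op g (mult_op h (tail M)) n\<bar> \<le> ell2_norm (mult_op g (mult_op h (tail M)))"
        by (intro abs_le_ell2_norm mult_op_bound(1)[OF g c(2,1)] htail)
      also have "\<dots> \<le> c * ell2_norm (mult_op h (tail M))"
        by (rule mult_op_bound(2)[OF g c(2,1) htail])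
      also have "\<dots> \<le> c * (d * ell2_norm (tail M))"
        by (intro mult_left_mono mult_op_bound(2)[OF h d(2,1) tail] c)
      finally show ?thesis by simp
    qed
    then show "\<forall>\<^sub>F M in sequentially.
        norm (mult_op g (mult_op h (tail M)) n) \<le> c * (d * ell2_norm (tail M))"
      by simp
    show "(\<lambda>M. c * (d * ell2_norm (tail M))) \<longlonglongrightarrow> 0"
      unfolding tail_def by (intro tendsto_mult_right_zero ell2_norm_tail_tendsto_0 f)
  qed
  moreover have "(\<lambda>M. \<Sum>j<M. f j * ?K j n) \<longlonglongrightarrow> mult_op (\<lambda>x. g x * h x) f n"
    unfolding mult_op_def by (intro summable_LIMSEQ mult_op_summable continuous_intros g h f)
  ultimately have "(\<lambda>M. (\<Sum>j<M. f j * ?K j n) + mult_op g (mult_op h (tail M)) n) \<longlonglongrightarrow>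
                     mult_op (\<lambda>x. g x * h x) f n + 0"
    by (intro tendsto_add)
  then show ?thesis
    by (simp add: eq[symmetric] LIMSEQ_const_iff)
qed

lemma mult_op_one: "mult_op (\<lambda>_. 1) f n = f n"
proof -
  have "mult_op (\<lambda>_. 1) f n = (\<Sum>m. if m = n then f m else 0)"
    by (simp add: mult_op_def mult_matrix_def orthonormal if_distrib cong: if_cong)
  also have "\<dots> = f n"
    using sums_single[of n f] by (simp add: sums_iff)
  finally show ?thesis .
qed

lemma mult_op_diff:
  assumes g: "continuous_on X g" and h: "continuous_on X h" and f: "f \<in> ell2"
  shows "mult_op (\<lambda>x. g x - h x) f n = mult_op g f n - mult_op h f n"
proof -
  have "mult_matrix (\<lambda>x. g x - h x) m n = mult_matrix g m n - mult_matrix h m n" for m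
    unfolding mult_matrix_def left_diff_distrib
    by (intro Bochner_Integration.integral_diff integrable_continuous continuous_intros g h)
  then show ?thesis
    by (simp add: mult_op_def right_diff_distrib suminf_diff mult_op_summable g h f)
qed

end

section \<open>The heat semigroup\<close>

text \<open>
  The restricted measure is finite because \<open>p 0\<close> is a constant, nonzero by normalisation, whose square
  is integrable over the support.
\<close>

lemma jacobi_spectral_pair_orthonormal:
  assumes "jacobi_spectral_pair a b \<mu> p"
  shows "orthonormal_polynomials (restrict_space \<mu> (measure_support \<mu>)) p"
    and "space (restrict_space \<mu> (measure_support \<mu>)) = measure_support \<mu>"
proof -
  let ?X = "measure_support \<mu>"
  have sets: "sets \<mu> = sets borel" and cpt: "compact ?X" and deg: "\<And>n. degree (p n) = n"
    and int: "\<And>n m. set_integrable \<mu> ?X (\<lambda>x. poly (p n) x * poly (p m) x)"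
    and ortho: "\<And>n m. (LINT x:?X|\<mu>. poly (p n) x * poly (p m) x) = (if n = m then 1 else 0)"
    using assms by (auto simp: jacobi_spectral_pair_def)
  have X: "?X \<in> sets \<mu>"
    using cpt by (simp add: sets compact_imp_closed)
  have space: "space \<mu> = UNIV"
    using sets_eq_imp_space_eq[OF sets] by simp
  then show sp: "space (restrict_space \<mu> ?X) = ?X"
    by (simp add: space_restrict_space)
  obtain k where k: "p 0 = [:k:]"
    using deg[of 0] degree_eq_zeroE by blast
  have "k \<noteq> 0"
    using ortho[of 0 0] by (auto simp: k)
  have "integrable \<mu> (\<lambda>x. indicator ?X x * (k * k))"
    using int[of 0 0] by (simp add: k set_integrable_def)
  then have "integrable \<mu> (indicator ?X :: real \<Rightarrow> real)"
    using \<open>k \<noteq> 0\<close> by simp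
  then have "emeasure \<mu> ?X < \<infinity>"
    using X by (simp add: integrable_indicator_iff space)
  then have fin: "finite_measure (restrict_space \<mu> ?X)"
    using X by (intro finite_measureI) (simp add: sp emeasure_restrict_space)
  show "orthonormal_polynomials (restrict_space \<mu> ?X) p"
  proof (intro orthonormal_polynomials.intro fin orthonormal_polynomials_axioms.intro)
    show "sets (restrict_space \<mu> ?X) = sets (restrict_space borel (space (restrict_space \<mu> ?X)))"
      unfolding sp by (rule sets_restrict_space_cong[OF sets])
    show "(\<integral>x. poly (p n) x * poly (p m) x \<partial>restrict_space \<mu> ?X) = (if n = m then 1 else 0)" for n m
      using ortho[of n m] X
      by (simp add: integral_restrict_space set_lebesgue_integral_def space)
  qed (use cpt deg sp in auto)
qed

theorem theorem2p1:
  fixes a b :: "nat \<Rightarrow> real" and \<alpha> \<beta> :: real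
    and \<mu> :: "real measure" and p :: "nat \<Rightarrow> real poly"
  assumes "\<And>n. a n > 0"
    and "a \<longlonglongrightarrow> \<alpha>" and "b \<longlonglongrightarrow> \<beta>"
    and "jacobi_spectral_pair a b \<mu> p"
  shows "\<forall>f \<in> ell2.
      (\<forall>t\<ge>0. (\<forall>n. summable (\<lambda>m. f m * heat_kernel \<mu> p t m n)) \<and>
              heat_op \<mu> p t f \<in> ell2 \<and>
              ell2_norm (heat_op \<mu> p t f) \<le> ell2_norm f) \<and>
      (\<forall>t1\<ge>0. \<forall>t2\<ge>0. \<forall>n.
              heat_op \<mu> p t1 (heat_op \<mu> p t2 f) n = heat_op \<mu> p (t1 + t2) f n) \<and>
      (\<forall>n. heat_op \<mu> p 0 f n = f n) \<and>
      ((\<lambda>t. ell2_norm (\<lambda>n. heat_op \<mu> p t f n - f n)) \<longlongrightarrow> 0) (at_right 0)"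
proof -
  define \<nu> where "\<nu> = restrict_space \<mu> (measure_support \<mu>)"
  interpret orthonormal_polynomials \<nu> p
    unfolding \<nu>_def by (rule jacobi_spectral_pair_orthonormal[OF assms(4)])
  have space: "X = measure_support \<mu>"
    unfolding \<nu>_def by (rule jacobi_spectral_pair_orthonormal[OF assms(4)])
  define s where "s = max (Sup X) 0"
  define g where "g = (\<lambda>t x. exp ((x - s) * t))"
  have g: "continuous_on X (g t)" for t
    unfolding g_def by (intro continuous_intros)
  have le_s: "x \<le> s" if "x \<in> X" for x
    using cSup_upper[OF that] compact_imp_bounded[OF compact_space]
    by (simp add: s_def bounded_imp_bdd_above le_max_iff_disj)
  have g_le: "\<bar>g t x\<bar> \<le> 1" if "x \<in> X" "t \<ge> 0" for t x
    using le_s[OF that(1)] that(2) by (simp add: g_def mult_nonpos_nonneg)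
  have "X \<in> sets \<mu>" and "space \<mu> = UNIV"
  proof -
    have sets: "sets \<mu> = sets borel"
      using assms(4) by (simp add: jacobi_spectral_pair_def)
    show "X \<in> sets \<mu>"
      by (simp add: sets compact_space compact_imp_closed)
    show "space \<mu> = UNIV"
      using sets_eq_imp_space_eq[OF sets] by simp
  qed
  then have "integral\<^sup>L \<nu> h = (LINT x:X|\<mu>. h x)" for h :: "real \<Rightarrow> real"
    unfolding space by (simp add: \<nu>_def integral_restrict_space set_lebesgue_integral_def)
  then have kernel: "heat_kernel \<mu> p t m n = mult_matrix (g t) m n" for t m n
    unfolding heat_kernel_def mult_matrix_def g_def s_def space by simp
  have op: "heat_op \<mu> p t = mult_op (g t)" for t
    by (simp add: fun_eq_iff heat_op_def mult_op_def kernel)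
  have "continuous_on X (\<lambda>x. x - s)"
    by (intro continuous_intros)
  then obtain B where B: "B \<ge> 0" "\<And>x. x \<in> X \<Longrightarrow> \<bar>x - s\<bar> \<le> B"
    using continuous_bounded_on_space by metis
  \<comment> \<open>Above, \<open>g t x \<le> 1\<close>; below, the tangent line of the exponential at \<open>0\<close>.\<close>
  have g_diff: "\<bar>g t x - 1\<bar> \<le> B * t" if "x \<in> X" "t \<ge> 0" for t x
  proof -
    have "1 + (x - s) * t \<le> g t x"
      unfolding g_def by (rule exp_ge_add_one_self)
    moreover have "\<bar>x - s\<bar> * t \<le> B * t"
      by (intro mult_right_mono B that)
    moreover have "\<bar>x - s\<bar> = s - x"
      using le_s[OF that(1)] by simp
    ultimately show ?thesis
      using g_le[OF that] by (simp add: algebra_simps)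
  qed
  show ?thesis
  proof (intro ballI conjI allI impI)
    fix f assume f: "f \<in> ell2"
    show "summable (\<lambda>m. f m * heat_kernel \<mu> p t m n)" for t n
      unfolding kernel by (rule mult_op_summable[OF g f])
    show "heat_op \<mu> p t f \<in> ell2" "ell2_norm (heat_op \<mu> p t f) \<le> ell2_norm f" if "t \<ge> 0" for t
      using mult_op_bound[OF g g_le[OF _ that] _ f] by (simp_all add: op)
    show "heat_op \<mu> p t1 (heat_op \<mu> p t2 f) n = heat_op \<mu> p (t1 + t2) f n" for t1 t2 n
    proof -
      have "(\<lambda>x. g t1 x * g t2 x) = g (t1 + t2)"
        by (simp add: g_def exp_add[symmetric] algebra_simps)
      then show ?thesis
        using mult_op_compose[OF g g f] by (simp add: op)
    qed
    have "g 0 = (\<lambda>_. 1)"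
      by (simp add: g_def)
    then show "heat_op \<mu> p 0 f n = f n" for n
      by (simp add: op mult_op_one)
    have norm_diff: "norm (ell2_norm (\<lambda>n. heat_op \<mu> p t f n - f n)) \<le> B * t * ell2_norm f"
      if "t > 0" for t
    proof -
      have eq: "(\<lambda>n. heat_op \<mu> p t f n - f n) = mult_op (\<lambda>x. g t x - 1) f"
        by (simp add: op fun_eq_iff mult_op_diff[OF g continuous_on_const f] mult_op_one)
      have "continuous_on X (\<lambda>x. g t x - 1)"
        by (intro continuous_intros g)
      from mult_op_bound[OF this g_diff _ f] that B(1) show ?thesis
        by (simp add: eq ell2_norm_nonneg)
    qed
    have lim: "((\<lambda>t. B * t * ell2_norm f) \<longlongrightarrow> B * 0 * ell2_norm f) (at_right 0)"
      by (intro tendsto_intros)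
    show "((\<lambda>t. ell2_norm (\<lambda>n. heat_op \<mu> p t f n - f n)) \<longlongrightarrow> 0) (at_right 0)"
      by (rule Lim_null_comparison[OF eventually_mono[OF eventually_at_right_less norm_diff]])
         (use lim in auto)
  qed
qed

end
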